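(* Assume the ABC conjecture. Let $f(x)\in\mathbb{Q}[x]$ be a polynomial of degree $d\ge 2$ which is not a monomial and has at least two distinct roots. Fix a non-zero integer $b$ and positive integers $A_1,\dots,A_r$. Then the equation $$b\,n_1!!\,A_1^{n_1}\cdots n_r!!\,A_r^{n_r}=f(x)$$ has only finitely many solutions $(x,n_1,\dots,n_r)$ with $x\in\mathbb{Z}$ and $n_1,\dots,n_r$ positive integers.
   Context: For a positive integer $m$, the double factorial $m!!$ is the product of all positive integers $\le m$ having the same parity as $m$, i.e. $m!!=m(m-2)(m-4)\cdots$, ending in $1$ if $m$ is odd and in $2$ if $m$ is even. For a non-zero integer $a$, its radical is $N(a)=\prod_{p\mid a}p$ (product over primes dividing $a$). The ABC conjecture: for every $\epsilon>0$ there is a constant $K(\epsilon)$ depending only on $\epsilon$ such that whenever $A,B,C$ are pairwise coprime non-zero integers with $A+B=C$, one has $\max\{|A|,|B|,|C|\}<K(\epsilon)\,N(ABC)^{1+\epsilon}$. *)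

theory Defs
  imports Complex_Main "HOL-Computational_Algebra.Computational_Algebra" "HOL-Library.FuncSet"
begin

definition double_factorial :: "nat \<Rightarrow> nat" where
  "double_factorial m = \<Prod>{k. 1 \<le> k \<and> k \<le> m \<and> even k = even m}"

(* Primes of type int are positive, so each prime divisor of a is counted once, without sign. *)
definition int_radical :: "int \<Rightarrow> int" where
  "int_radical a = \<Prod>(prime_factors a)"

definition ABC_conjecture :: bool where
  "ABC_conjecture \<longleftrightarrow>
    (\<forall>\<epsilon>::real. \<epsilon> > 0 \<longrightarrow>
      (\<exists>K::real. \<forall>A B C::int.
        A \<noteq> 0 \<and> B \<noteq> 0 \<and> C \<noteq> 0 \<and>
        coprime A B \<and> coprime A C \<and> coprime B C \<and> A + B = C \<longrightarrow>
        real_of_int (Max {\<bar>A\<bar>, \<bar>B\<bar>, \<bar>C\<bar>})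
          < K * real_of_int (int_radical (A * B * C)) powr (1 + \<epsilon>)))"

end

theory Submission
  imports Defs
begin

text \<open>An affine change of variable turns \<open>m f(x)\<close> into \<open>\<alpha> y\<^sup>d + Q(y)\<close> with \<open>deg Q \<le> d - 2\<close>, and
  \<open>Q \<noteq> 0\<close> because \<open>f\<close> has two distinct roots. Apply the ABC conjecture to
  \<open>\<alpha> y\<^sup>d + Q(y) = L\<close> divided by \<open>D = gcd(\<alpha> y\<^sup>d, Q(y))\<close>: the radical of the product is at most a
  constant times \<open>\<bar>y\<bar> \<cdot> \<bar>y\<bar>\<^bsup>d-2\<^esup> \<cdot> N(L) / D\<close>, so for small \<open>\<epsilon>\<close> both \<open>y\<close> and \<open>L\<close> are bounded by a power of
  \<open>N(L)\<close>. When \<open>L\<close> is \<open>m\<close> times the left-hand side of the equation and \<open>n = max n\<^sub>i\<close>, the radical \<open>N(L)\<close>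
  grows at most exponentially in \<open>n\<close> by the primorial bound, whereas \<open>\<bar>L\<bar> \<ge> n!!\<close>, so \<open>n\<close> is bounded.\<close>

section \<open>Elementary facts about double factorials\<close>

lemma double_factorial_0 [simp]: "double_factorial 0 = 1"
  unfolding double_factorial_def by (intro prod.neutral) auto

lemma double_factorial_1 [simp]: "double_factorial (Suc 0) = 1"
  unfolding double_factorial_def by (intro prod.neutral) auto

lemma double_factorial_Suc_Suc [simp]:
  "double_factorial (Suc (Suc n)) = Suc (Suc n) * double_factorial n"
proof -
  have "{k. 1 \<le> k \<and> k \<le> Suc (Suc n) \<and> even k = even (Suc (Suc n))}
      = insert (Suc (Suc n)) {k. 1 \<le> k \<and> k \<le> n \<and> even k = even n}"
    by (auto simp: le_Suc_eq)
  moreover have "finite {k. 1 \<le> k \<and> k \<le> n \<and> even k = even n}"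
    by (rule finite_subset[of _ "{..n}"]) auto
  ultimately show ?thesis
    by (simp add: double_factorial_def)
qed

lemma double_factorial_pos: "double_factorial n > 0"
  by (induction n rule: induct_nat_012) auto

lemma double_factorial_ge: "n \<le> double_factorial n"
proof (induction n rule: induct_nat_012)
  case (ge2 n)
  then show ?case
    using double_factorial_pos[of n] mult_le_mono2[of 1 "double_factorial n" "Suc (Suc n)"] by simp
qed auto

lemma double_factorial_le_Suc: "double_factorial n \<le> double_factorial (Suc n)"
proof (induction n rule: induct_nat_012)
  case (ge2 n)
  then show ?case
    unfolding double_factorial_Suc_Suc by (intro mult_le_mono) auto
qed auto

lemma fact_Suc_eq_double_factorial:
  "fact (Suc n) = double_factorial (Suc n) * double_factorial n"
proof (induction n)
  case (Suc n)
  have "fact (Suc (Suc n)) = Suc (Suc n) * (double_factorial (Suc n) * double_factorial n)"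
    using Suc by (metis fact_Suc of_nat_id)
  then show ?case by (simp only: double_factorial_Suc_Suc mult_ac)
qed simp

text \<open>In \<open>n! = n!! (n-1)!!\<close> the second factor is at most the first. This is what
  makes \<open>n!!\<close> outgrow every exponential.\<close>

lemma fact_le_double_factorial_square: "fact n \<le> (double_factorial n)\<^sup>2"
proof (cases n)
  case (Suc m)
  then show ?thesis
    unfolding Suc fact_Suc_eq_double_factorial power2_eq_square
    by (intro mult_le_mono double_factorial_le_Suc order_refl)
qed simp

lemma double_factorial_dvd_fact: "double_factorial n dvd fact n"
  by (cases n) (auto simp: fact_Suc_eq_double_factorial simp del: fact_Suc)

lemma prime_dvd_double_factorial_le:
  assumes "prime p" "p dvd double_factorial n"
  shows "p \<le> n"
  using dvd_trans[OF assms(2) double_factorial_dvd_fact] assms(1) prime_dvd_fact_iff by blast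

section \<open>An exponential bound for the product of the primes up to \<open>n\<close>\<close>

text \<open>The two middle entries of row \<open>2 * m + 1\<close> are equal, and their sum is at
  most the row sum \<open>2 * 4 ^ m\<close>.\<close>

lemma central_binomial_Suc_le: "(2 * m + 1) choose m \<le> 4 ^ m"
proof -
  have "2 * ((2 * m + 1) choose m) = (\<Sum>k\<in>{m, Suc m}. (2 * m + 1) choose k)"
    using binomial_symmetric[of m "2 * m + 1"] by simp
  also have "\<dots> \<le> (\<Sum>k\<le>2 * m + 1. (2 * m + 1) choose k)"
    by (intro sum_mono2) auto
  also have "\<dots> = 2 * 4 ^ m"
    unfolding choose_row_sum by (simp add: power_mult)
  finally show ?thesis by simp
qed

text \<open>Distinct primes are coprime because \<open>prime\<close> includes normalization. The
  general type serves natural numbers in the primorial bound and integers for radicals.\<close>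

lemma prod_primes_dvd:
  fixes a :: "'a :: factorial_semiring_gcd"
  assumes "finite S" "\<And>p. p \<in> S \<Longrightarrow> prime p" "\<And>p. p \<in> S \<Longrightarrow> p dvd a"
  shows "\<Prod>S dvd a"
  using assms
proof (induction S)
  case (insert p S)
  have "coprime p (\<Prod>S)"
    using insert by (intro prod_coprime_right primes_coprime) auto
  then have "p * \<Prod>S dvd a"
    using insert by (intro divides_mult) auto
  then show ?case using insert by simp
qed simp

text \<open>Erdos's argument: an even \<open>n > 2\<close> adds no prime, and for
  \<open>n = 2 * m + 1\<close> the primes above \<open>m + 1\<close> all divide
  \<open>n choose m\<close>, while those up to \<open>m + 1\<close> are covered by
  induction.\<close>

lemma primorial_le: "\<Prod>{p::nat. prime p \<and> p \<le> n} \<le> 4 ^ n"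
proof (induction n rule: less_induct)
  case (less n)
  let ?P = "\<lambda>n. {p::nat. prime p \<and> p \<le> n}"
  have fin: "finite (?P k)" for k by (rule finite_subset[of _ "{..k}"]) auto
  have "n < 2 \<or> n = 2 \<or> (n > 2 \<and> even n) \<or> (\<exists>m. n = 2 * m + 1 \<and> m > 0)"
    by presburger
  then consider "n < 2" | "n = 2" | "n > 2" "even n" | m where "n = 2 * m + 1" "m > 0"
    by blast
  then show ?case
  proof cases
    case 1
    then have empty: "?P n = {}" by (auto dest: prime_ge_2_nat)
    show ?thesis unfolding empty by simp
  next
    case 2
    have two: "?P 2 = {2}" by (auto dest: prime_ge_2_nat)
    show ?thesis unfolding 2 two by simp
  next
    case 3
    then have "\<not> prime n" using prime_odd_nat by blast
    then have "p \<le> n \<longleftrightarrow> p \<le> n - 1" if "prime p" for p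
      using that by (cases "p = n") auto
    then have "?P n = ?P (n - 1)" by auto
    moreover have "\<Prod>(?P (n - 1)) \<le> 4 ^ (n - 1)" using 3 by (intro less) auto
    moreover have "(4::nat) ^ (n - 1) \<le> 4 ^ n" by (intro power_increasing) auto
    ultimately show ?thesis by (metis order_trans)
  next
    case 4
    let ?Q = "{p::nat. prime p \<and> Suc m < p \<and> p \<le> n}"
    have finQ: "finite ?Q" by (rule finite_subset[OF _ fin[of n]]) auto
    \<comment> \<open>Such a \<open>p\<close> divides \<open>n!\<close> but neither
      \<open>m!\<close> nor \<open>(m+1)!\<close>, so it must divide the binomial
      coefficient.\<close>
    have "p dvd n choose m" if "p \<in> ?Q" for p
    proof -
      have "p dvd fact n" using that by (simp add: prime_dvd_fact_iff)
      also have "fact n = fact m * fact (Suc m) * (n choose m)"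
        using binomial_fact_lemma[of m n] 4 by (simp del: fact_Suc)
      finally show ?thesis
        using that by (simp add: prime_dvd_mult_iff prime_dvd_fact_iff del: fact_Suc)
    qed
    then have "\<Prod>?Q dvd n choose m"
      using finQ by (intro prod_primes_dvd) auto
    then have Q: "\<Prod>?Q \<le> 4 ^ m"
      using central_binomial_Suc_le[of m] 4 by (auto dest!: dvd_imp_le)
    \<comment> \<open>The induction hypothesis needs \<open>Suc m < 2 * m + 1\<close>, which is why
      the case has \<open>m > 0\<close>.\<close>
    have P: "\<Prod>(?P (Suc m)) \<le> 4 ^ Suc m" using 4 by (intro less) auto
    have "Suc m \<le> n" using 4 by simp
    then have split: "?P n = ?P (Suc m) \<union> ?Q" by auto
    have "\<Prod>(?P n) = \<Prod>(?P (Suc m)) * \<Prod>?Q"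
      unfolding split by (rule prod.union_disjoint[OF fin finQ]) auto
    also have "\<dots> \<le> 4 ^ Suc m * 4 ^ m" using P Q by (rule mult_le_mono)
    also have "\<dots> = 4 ^ n" using 4 by (simp add: power_add power_mult power2_eq_square flip: power_mult_distrib)
    finally show ?thesis .
  qed
qed

section \<open>Radicals of integers\<close>

lemma int_radical_pos: "int_radical a > 0"
  unfolding int_radical_def
  by (rule prod_pos) (use prime_gt_0_int in_prime_factors_imp_prime in blast)

lemma int_radical_dvd: "int_radical a dvd a"
  unfolding int_radical_def by (rule prod_primes_dvd) auto

lemma int_radical_le_abs: "a \<noteq> 0 \<Longrightarrow> int_radical a \<le> \<bar>a\<bar>"
  using int_radical_dvd dvd_imp_le_int[of a "int_radical a"] int_radical_pos[of a] by simp

lemma int_radical_dvd_if_subset: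
  "prime_factors a \<subseteq> prime_factors b \<Longrightarrow> int_radical a dvd int_radical b"
  unfolding int_radical_def by (rule prod_dvd_prod_subset) auto

lemma int_radical_le_if_subset:
  "prime_factors a \<subseteq> prime_factors b \<Longrightarrow> int_radical a \<le> int_radical b"
  using int_radical_dvd_if_subset int_radical_pos zdvd_imp_le by blast

lemma int_radical_mult_le:
  assumes "a \<noteq> 0" "b \<noteq> 0"
  shows "int_radical (a * b) \<le> int_radical a * int_radical b"
proof -
  have "int_radical (a * b) dvd int_radical a * int_radical b"
    unfolding int_radical_def[of "a * b"]
  proof (rule prod_primes_dvd)
    fix p assume p: "p \<in> prime_factors (a * b)"
    then consider "p \<in> prime_factors a" | "p \<in> prime_factors b"
      using assms prime_factors_product by blast
    then show "p dvd int_radical a * int_radical b"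
      unfolding int_radical_def
      using dvd_prodI[of "prime_factors a" p "\<lambda>x. x"] dvd_prodI[of "prime_factors b" p "\<lambda>x. x"]
      by cases (auto intro: dvd_mult dvd_mult2)
  qed auto
  then show ?thesis
    by (rule zdvd_imp_le) (simp add: int_radical_pos)
qed

section \<open>The ABC conjecture applied to polynomial values\<close>

lemma abs_poly_int_le:
  fixes p :: "int poly"
  assumes "degree p \<le> n"
  obtains c where "c \<ge> 1" "\<And>y. y \<noteq> 0 \<Longrightarrow> \<bar>poly p y\<bar> \<le> c * \<bar>y\<bar> ^ n"
proof
  \<comment> \<open>The summand 1 keeps the constant at least 1 even for the zero
    polynomial.\<close>
  let ?c = "1 + (\<Sum>i\<le>degree p. \<bar>coeff p i\<bar>)"
  show "?c \<ge> 1" by (simp add: sum_nonneg)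
  fix y :: int assume "y \<noteq> 0"
  then have y: "\<bar>y\<bar> \<ge> 1" by simp
  have "\<bar>poly p y\<bar> \<le> (\<Sum>i\<le>degree p. \<bar>coeff p i * y ^ i\<bar>)"
    unfolding poly_altdef by (rule sum_abs)
  also have "\<dots> \<le> (\<Sum>i\<le>degree p. \<bar>coeff p i\<bar> * \<bar>y\<bar> ^ n)"
    unfolding abs_mult power_abs using y assms
    by (intro sum_mono mult_left_mono power_increasing) auto
  also have "\<dots> \<le> ?c * \<bar>y\<bar> ^ n"
    by (simp add: algebra_simps sum_distrib_left)
  finally show "\<bar>poly p y\<bar> \<le> ?c * \<bar>y\<bar> ^ n" .
qed

text \<open>This is where the power is gained: the radical of \<open>a * y ^ d\<close> is controlled
  by \<open>a * y\<close>, whatever \<open>d\<close> is.\<close>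

lemma prime_factors_mult_power_subset:
  fixes a y :: int
  assumes "a \<noteq> 0" "y \<noteq> 0"
  shows "prime_factors (a * y ^ d) \<subseteq> prime_factors (a * y)"
  using assms by (auto simp: prime_factors_dvd prime_dvd_mult_iff dest: prime_dvd_power)

text \<open>After division by \<open>D = gcd A B\<close>, the radical of \<open>B / D\<close> is estimated by \<open>\<bar>B\<bar> / D\<close>; the factor
  \<open>D\<close> lost on the left is outweighed by \<open>D powr (1 + \<epsilon>)\<close> on the right.\<close>

lemma ABC_with_common_factor:
  assumes ABC_conjecture and "\<epsilon> > 0"
  obtains K :: real where "K > 0"
    "\<And>A B :: int. A \<noteq> 0 \<Longrightarrow> B \<noteq> 0 \<Longrightarrow> A + B \<noteq> 0 \<Longrightarrow>
      real_of_int \<bar>A\<bar> \<le> K * (real_of_int (int_radical A) * \<bar>B\<bar> * int_radical (A + B)) powr (1 + \<epsilon>)"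
proof -
  from assms obtain K0 :: real where K0: "\<And>A B C::int. A \<noteq> 0 \<Longrightarrow> B \<noteq> 0 \<Longrightarrow> C \<noteq> 0 \<Longrightarrow>
        coprime A B \<Longrightarrow> coprime A C \<Longrightarrow> coprime B C \<Longrightarrow> A + B = C \<Longrightarrow>
        real_of_int (Max {\<bar>A\<bar>, \<bar>B\<bar>, \<bar>C\<bar>})
          < K0 * real_of_int (int_radical (A * B * C)) powr (1 + \<epsilon>)"
    unfolding ABC_conjecture_def by meson
  \<comment> \<open>The conjecture says nothing about the sign of its constant; a positive one is
    needed to multiply inequalities by it.\<close>
  define K where "K = max K0 1"
  have "K > 0" by (simp add: K_def)
  moreover have "real_of_int \<bar>A\<bar> \<le> K * (real_of_int (int_radical A) * \<bar>B\<bar> * int_radical (A + B)) powr (1 + \<epsilon>)"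
    if nz: "A \<noteq> 0" "B \<noteq> 0" "A + B \<noteq> 0" for A B :: int
  proof -
    define D where "D = gcd A B"
    have D: "D \<ge> 1" using nz by (simp add: D_def int_one_le_iff_zero_less)
    obtain a b where a: "A = a * D" and b: "B = b * D" and cop: "coprime a b"
      using gcd_coprime_exists[of A B] D unfolding D_def by (metis not_one_le_zero)
    have nz': "a \<noteq> 0" "b \<noteq> 0" "a + b \<noteq> 0" using nz by (auto simp: a b simp flip: distrib_right)
    let ?R = "int_radical A * \<bar>b\<bar> * int_radical (A + B)"
    have "int_radical (a * b * (a + b)) \<le> int_radical (a * b) * int_radical (a + b)"
      using nz' by (intro int_radical_mult_le) auto
    also have "\<dots> \<le> (int_radical a * int_radical b) * int_radical (a + b)"
      using nz' by (intro mult_right_mono int_radical_mult_le) (auto intro: less_imp_le int_radical_pos)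
    \<comment> \<open>Every prime of \<open>a\<close> or \<open>a + b\<close> also divides
      \<open>A\<close> or \<open>A + B\<close> respectively. The factor \<open>b\<close> enters with
      its full size, so that multiplying by \<open>D\<close> later restores
      \<open>B\<close>.\<close>
    also have "\<dots> \<le> ?R"
    proof (intro mult_mono int_radical_le_if_subset int_radical_le_abs)
      show "prime_factors a \<subseteq> prime_factors A" "prime_factors (a + b) \<subseteq> prime_factors (A + B)"
        using nz by (auto simp: a b prime_factors_dvd simp flip: distrib_right)
    qed (use nz' in \<open>auto intro!: mult_nonneg_nonneg less_imp_le[OF int_radical_pos]\<close>)
    finally have rad: "real_of_int (int_radical (a * b * (a + b))) \<le> real_of_int ?R"
      unfolding of_int_le_iff .
    have "coprime a (a + b)" "coprime b (a + b)"
      using cop by (metis coprime_iff_gcd_eq_1 gcd_add1 gcd_add2 gcd.commute)+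
    then have max_less: "real_of_int (Max {\<bar>a\<bar>, \<bar>b\<bar>, \<bar>a + b\<bar>})
        < K0 * real_of_int (int_radical (a * b * (a + b))) powr (1 + \<epsilon>)"
      by (intro K0 nz' cop refl)
    have "real_of_int \<bar>a\<bar> \<le> real_of_int (Max {\<bar>a\<bar>, \<bar>b\<bar>, \<bar>a + b\<bar>})" by simp
    also have "\<dots> < K0 * real_of_int (int_radical (a * b * (a + b))) powr (1 + \<epsilon>)"
      by (rule max_less)
    also have "\<dots> \<le> K * real_of_int ?R powr (1 + \<epsilon>)"
      using rad int_radical_pos[of "a * b * (a + b)"] \<open>\<epsilon> > 0\<close> unfolding K_def
      by (intro mult_mono powr_mono2) auto
    finally have main: "real_of_int \<bar>a\<bar> \<le> K * real_of_int ?R powr (1 + \<epsilon>)" by simp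
    have "real_of_int \<bar>A\<bar> = real_of_int \<bar>a\<bar> * D" using D by (simp add: a abs_mult)
    also have "\<dots> \<le> (K * real_of_int ?R powr (1 + \<epsilon>)) * D"
      using main D by (intro mult_right_mono) auto
    also have "\<dots> \<le> (K * real_of_int ?R powr (1 + \<epsilon>)) * (real_of_int D powr (1 + \<epsilon>))"
      using D \<open>\<epsilon> > 0\<close> \<open>K > 0\<close> powr_mono[of 1 "1 + \<epsilon>" "real_of_int D"] by (intro mult_left_mono) auto
    also have "\<dots> = K * (real_of_int ?R * D) powr (1 + \<epsilon>)"
      using D int_radical_pos[of A] int_radical_pos[of "A + B"]
      by (subst powr_mult) auto
    also have "real_of_int ?R * D = real_of_int (int_radical A) * \<bar>B\<bar> * int_radical (A + B)"
      using D by (simp add: b abs_mult mult_ac)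
    finally show ?thesis .
  qed
  ultimately show thesis using that by blast
qed

text \<open>The radical of the leading term times \<open>\<bar>poly Q y\<bar>\<close> has order at
  most \<open>d - 1\<close> in \<open>y\<close>, one less than the leading term itself. A small
  \<epsilon> preserves part of this gap, which bounds \<open>y\<close>, and then the whole value, by
  a power of the radical of the value.\<close>

lemma ABC_abs_poly_value_le:
  fixes \<alpha> :: int and Q :: "int poly"
  assumes ABC_conjecture and "\<alpha> \<noteq> 0" and deg: "degree Q + 2 \<le> d"
  obtains K :: real and k :: nat where
    "\<And>y. y \<noteq> 0 \<Longrightarrow> poly Q y \<noteq> 0 \<Longrightarrow> \<alpha> * y ^ d + poly Q y \<noteq> 0 \<Longrightarrow>
       real_of_int \<bar>\<alpha> * y ^ d + poly Q y\<bar> \<le> K * real_of_int (int_radical (\<alpha> * y ^ d + poly Q y)) ^ k"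
proof -
  \<comment> \<open>Chosen so that \<open>(d - 1) * (1 + \<epsilon>) = d - 1/2\<close>: exactly a
    square root of \<open>\<bar>y\<bar>\<close> is left over.\<close>
  define \<epsilon> where "\<epsilon> = 1 / (2 * (real d - 1))"
  have \<epsilon>: "\<epsilon> > 0" "1 + \<epsilon> \<le> 2" using deg by (auto simp: \<epsilon>_def field_simps)
  have exponent: "(real d - 1) * (1 + \<epsilon>) = real d - 1 / 2" using deg by (simp add: \<epsilon>_def field_simps)
  obtain K where "K > 0" and K: "\<And>A B :: int. A \<noteq> 0 \<Longrightarrow> B \<noteq> 0 \<Longrightarrow> A + B \<noteq> 0 \<Longrightarrow>
      real_of_int \<bar>A\<bar> \<le> K * (real_of_int (int_radical A) * \<bar>B\<bar> * int_radical (A + B)) powr (1 + \<epsilon>)"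
    using ABC_with_common_factor[OF assms(1) \<epsilon>(1)] by blast
  have "degree Q \<le> d - 2" using deg by simp
  then obtain c where "c \<ge> 1" and c: "\<And>y. y \<noteq> 0 \<Longrightarrow> \<bar>poly Q y\<bar> \<le> c * \<bar>y\<bar> ^ (d - 2)"
    using abs_poly_int_le by blast
  \<comment> \<open>The final estimate is \<open>(\<bar>\<alpha>\<bar> + c) * Y ^ d\<close> with
    \<open>Y \<le> K\<^sup>2 * s ^ 4\<close> and
    \<open>s = \<bar>\<alpha>\<bar> * c * \<rho>\<close>; splitting off the powers of
    \<open>\<rho>\<close> leaves this constant and the exponent \<open>4 * d\<close>.\<close>
  define K' where "K' = real_of_int (\<bar>\<alpha>\<bar> + c) * (K\<^sup>2 * real_of_int (\<bar>\<alpha>\<bar> * c) ^ 4) ^ d"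
  show thesis
  proof (rule that[of K' "4 * d"])
    fix y :: int
    let ?A = "\<alpha> * y ^ d" and ?B = "poly Q y"
    assume nz: "y \<noteq> 0" "?B \<noteq> 0" "?A + ?B \<noteq> 0"
    define \<rho> where "\<rho> = int_radical (?A + ?B)"
    have \<rho>: "\<rho> \<ge> 1" using int_radical_pos[of "?A + ?B"] by (simp add: \<rho>_def)
    define Y where "Y = real_of_int \<bar>y\<bar>"
    have Y: "Y \<ge> 1" using nz by (simp add: Y_def)
    define s where "s = real_of_int (\<bar>\<alpha>\<bar> * c * \<rho>)"
    have ac: "\<bar>\<alpha>\<bar> * c \<ge> 1" using \<open>c \<ge> 1\<close> \<open>\<alpha> \<noteq> 0\<close> by (simp add: int_one_le_iff_zero_less)
    have "\<bar>\<alpha>\<bar> * c * \<rho> \<ge> 1 * 1" using ac \<rho> by (intro mult_mono) auto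
    then have s: "s \<ge> 1" unfolding s_def by linarith
    have "int_radical ?A * \<bar>?B\<bar> * \<rho> \<le> (\<bar>\<alpha>\<bar> * \<bar>y\<bar>) * (c * \<bar>y\<bar> ^ (d - 2)) * \<rho>"
    proof (intro mult_mono c nz)
      have "int_radical ?A \<le> int_radical (\<alpha> * y)"
        using nz \<open>\<alpha> \<noteq> 0\<close> by (intro int_radical_le_if_subset prime_factors_mult_power_subset)
      also have "\<dots> \<le> \<bar>\<alpha> * y\<bar>" using nz \<open>\<alpha> \<noteq> 0\<close> by (intro int_radical_le_abs) auto
      finally show "int_radical ?A \<le> \<bar>\<alpha>\<bar> * \<bar>y\<bar>" by (simp add: abs_mult)
    qed (use \<rho> \<open>c \<ge> 1\<close> in auto)
    also have "\<dots> = (\<bar>\<alpha>\<bar> * c * \<rho>) * (\<bar>y\<bar> * \<bar>y\<bar> ^ (d - 2))" by (simp add: mult_ac)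
    also have "\<bar>y\<bar> * \<bar>y\<bar> ^ (d - 2) = \<bar>y\<bar> ^ (d - 1)"
      using deg power_Suc[of "\<bar>y\<bar>" "d - 2"] by (simp add: Suc_diff_Suc numeral_2_eq_2)
    finally have "real_of_int (int_radical ?A * \<bar>?B\<bar> * \<rho>) \<le> real_of_int ((\<bar>\<alpha>\<bar> * c * \<rho>) * \<bar>y\<bar> ^ (d - 1))"
      unfolding of_int_le_iff .
    then have R: "real_of_int (int_radical ?A) * \<bar>?B\<bar> * \<rho> \<le> s * Y ^ (d - 1)"
      by (simp add: s_def Y_def)
    have "Y ^ d \<le> real_of_int \<bar>?A\<bar>"
      using \<open>\<alpha> \<noteq> 0\<close> mult_right_mono[of 1 "real_of_int \<bar>\<alpha>\<bar>" "Y ^ d"] Y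
      by (simp add: Y_def abs_mult power_abs)
    also have "\<dots> \<le> K * (real_of_int (int_radical ?A) * \<bar>?B\<bar> * \<rho>) powr (1 + \<epsilon>)"
      unfolding \<rho>_def using nz \<open>\<alpha> \<noteq> 0\<close> by (intro K) auto
    also have "\<dots> \<le> K * (s * Y ^ (d - 1)) powr (1 + \<epsilon>)"
      using R \<open>K > 0\<close> \<epsilon> \<rho> int_radical_pos[of ?A] by (intro mult_left_mono powr_mono2) auto
    also have "\<dots> = K * (s powr (1 + \<epsilon>) * Y powr (real d - 1 / 2))"
    proof -
      have "(Y ^ (d - 1)) powr (1 + \<epsilon>) = Y powr ((real d - 1) * (1 + \<epsilon>))"
        using Y deg by (simp add: powr_powr of_nat_diff flip: powr_realpow)
      then show ?thesis using s Y by (simp add: powr_mult exponent)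
    qed
    \<comment> \<open>Since \<open>s \<ge> 1\<close>, its exponent may be rounded up to an
      integer.\<close>
    also have "\<dots> \<le> K * (s powr 2 * Y powr (real d - 1 / 2))"
      using s \<epsilon> \<open>K > 0\<close> by (intro mult_left_mono mult_right_mono powr_mono) auto
    also have "\<dots> = (K * s\<^sup>2) * (Y ^ d / sqrt Y)"
      using s Y by (simp add: powr_diff powr_realpow powr_half_sqrt powr_numeral)
    finally have "sqrt Y \<le> K * s\<^sup>2"
      using Y by (simp add: field_simps)
    then have "(sqrt Y)\<^sup>2 \<le> (K * s\<^sup>2)\<^sup>2" using Y by (intro power_mono) auto
    then have "Y \<le> K\<^sup>2 * s ^ 4" using Y by (simp add: power_mult_distrib flip: power_mult)
    then have Yd: "Y ^ d \<le> (K\<^sup>2 * s ^ 4) ^ d" using Y by (intro power_mono) auto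
    have "\<bar>?A + ?B\<bar> \<le> \<bar>\<alpha>\<bar> * \<bar>y\<bar> ^ d + c * \<bar>y\<bar> ^ (d - 2)"
      using c[OF nz(1)] abs_triangle_ineq[of ?A ?B] by (simp add: abs_mult power_abs)
    also have "\<dots> \<le> \<bar>\<alpha>\<bar> * \<bar>y\<bar> ^ d + c * \<bar>y\<bar> ^ d"
      using nz \<open>c \<ge> 1\<close> by (intro add_left_mono mult_left_mono power_increasing) auto
    finally have "real_of_int \<bar>?A + ?B\<bar> \<le> real_of_int ((\<bar>\<alpha>\<bar> + c) * \<bar>y\<bar> ^ d)"
      unfolding of_int_le_iff by (simp add: algebra_simps)
    also have "\<dots> = real_of_int (\<bar>\<alpha>\<bar> + c) * Y ^ d" by (simp add: Y_def)
    also have "\<dots> \<le> real_of_int (\<bar>\<alpha>\<bar> + c) * (K\<^sup>2 * s ^ 4) ^ d"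
      using Yd \<open>c \<ge> 1\<close> by (intro mult_left_mono) auto
    also have "\<dots> = K' * real_of_int \<rho> ^ (4 * d)"
      by (simp add: K'_def s_def power_mult_distrib mult_ac flip: power_mult)
    finally show "real_of_int \<bar>?A + ?B\<bar> \<le> K' * real_of_int (int_radical (?A + ?B)) ^ (4 * d)"
      by (simp add: \<rho>_def)
  qed
qed

section \<open>Reduction to an integer polynomial without second-highest term\<close>

text \<open>The second formula shows which shift \<open>t\<close> removes the second-highest
  coefficient. Only an upper bound on the degree is assumed, so that the induction passes to the
  tail of \<open>p\<close>; the second formula for \<open>p\<close> uses both formulas for the
  tail.\<close>

lemma coeff_pcompose_affine:
  fixes p :: "'a :: comm_ring_1 poly"
  assumes "degree p \<le> Suc n"
  shows "coeff (p \<circ>\<^sub>p [:t, s:]) (Suc n) = s ^ Suc n * coeff p (Suc n)"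
    and "coeff (p \<circ>\<^sub>p [:t, s:]) n = s ^ n * (coeff p n + of_nat (Suc n) * t * coeff p (Suc n))"
  using assms
proof (induction n arbitrary: p)
  case 0
  {
    case 1
    then obtain a b where "p = [:a, b:]"
      by (cases p) (auto split: if_splits elim: degree_eq_zeroE)
    then show ?case by (simp add: pcompose_pCons)
  next
    case 2
    then obtain a b where "p = [:a, b:]"
      by (cases p) (auto split: if_splits elim: degree_eq_zeroE)
    then show ?case by (simp add: pcompose_pCons)
  }
next
  case (Suc n)
  {
    case 1
    obtain a q where p: "p = pCons a q" by (cases p) auto
    with 1 have q: "degree q \<le> Suc n" by (cases "q = 0") simp_all
    have "degree (q \<circ>\<^sub>p [:t, s:]) \<le> Suc n * 1"
      by (rule order_trans[OF degree_pcompose_le]) (intro mult_le_mono q, simp)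
    then have "coeff (q \<circ>\<^sub>p [:t, s:]) (Suc (Suc n)) = 0" by (intro coeff_eq_0) simp
    then show ?case using Suc(1)[OF q] by (simp add: p pcompose_pCons algebra_simps)
  next
    case 2
    obtain a q where p: "p = pCons a q" by (cases p) auto
    with 2 have q: "degree q \<le> Suc n" by (cases "q = 0") simp_all
    show ?case
      using Suc(1,2)[OF q] by (simp add: p pcompose_pCons algebra_simps)
  }
qed

lemma rat_poly_clear_denominators:
  fixes p :: "rat poly"
  obtains m :: int and P :: "int poly" where "m > 0" "smult (of_int m) p = map_poly of_int P"
proof (induction p arbitrary: thesis)
  case 0
  show ?case by (rule 0[of 1 0]) auto
next
  case (pCons a p)
  obtain m P where m: "m > 0" and P: "smult (of_int m) p = map_poly of_int P"
    using pCons.IH by blast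
  obtain u v where "quotient_of a = (u, v)" by fastforce
  then have v: "v > 0" and a: "a = of_int u / of_int v"
    using quotient_of_denom_pos quotient_of_div by blast+
  show ?case
  proof (rule pCons.prems)
    show "m * v > 0" using m v by simp
    have "smult (of_int (m * v)) p = smult (of_int v) (map_poly of_int P)"
      by (simp add: mult.commute flip: P)
    also have "\<dots> = map_poly of_int (smult v P)"
      by (rule poly_eqI) (simp add: coeff_map_poly)
    finally show "smult (of_int (m * v)) (pCons a p) = map_poly of_int (pCons (m * u) (smult v P))"
      using v by (simp add: map_poly_pCons a)
  qed
qed

lemma poly_map_poly_of_int: "poly (map_poly of_int P) (of_int y) = (of_int (poly P y) :: 'a :: comm_ring_1)"
  by (induction P) (simp_all add: map_poly_pCons)

lemma map_poly_of_rat_monom: "map_poly of_rat (monom c n) = monom (of_rat c) n"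
  by (rule poly_eqI) (simp add: coeff_map_poly)

lemma map_poly_of_rat_add: "map_poly of_rat (p + q) = map_poly of_rat p + map_poly of_rat q"
  by (rule poly_eqI) (simp add: coeff_map_poly of_rat_add)

lemma map_poly_of_rat_smult: "map_poly of_rat (smult c p) = smult (of_rat c) (map_poly of_rat p)"
  by (rule poly_eqI) (simp add: coeff_map_poly of_rat_mult)

lemma map_poly_of_rat_mult: "map_poly of_rat (p * q) = map_poly of_rat p * map_poly of_rat q"
  by (induction p) (simp_all add: map_poly_pCons map_poly_of_rat_add map_poly_of_rat_smult)

text \<open>The change of variable is made over the rationals, but the two distinct roots are
  complex.\<close>

lemma map_poly_of_rat_pcompose:
  "map_poly of_rat (p \<circ>\<^sub>p q) = map_poly of_rat p \<circ>\<^sub>p map_poly of_rat q"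
  by (induction p)
    (simp_all add: map_poly_pCons map_poly_of_rat_add map_poly_of_rat_mult pcompose_pCons)

text \<open>The variable is \<open>y = v * x + u\<close>, an integer for integer \<open>x\<close>,
  where \<open>u / v\<close> is the shift that removes the second-highest coefficient. If
  \<open>Q\<close> were zero, \<open>f\<close> would be a constant times a power of
  \<open>v * x + u\<close>, hence would have only one root.\<close>

lemma depressed_integer_form:
  fixes f :: "rat poly" and z w :: complex
  assumes deg: "degree f \<ge> 2" and "z \<noteq> w"
    and roots: "poly (map_poly of_rat f) z = 0" "poly (map_poly of_rat f) w = 0"
  obtains m u v \<alpha> :: int and Q :: "int poly"
  where "m > 0" "\<alpha> \<noteq> 0" "Q \<noteq> 0" "degree Q + 2 \<le> degree f"
    "\<And>x :: int. of_int m * poly f (of_int x)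
       = of_int (\<alpha> * (v * x + u) ^ degree f + poly Q (v * x + u))"
proof -
  obtain n where n: "degree f = Suc n" "n \<ge> 1"
    using deg by (cases "degree f") auto
  define a where "a = coeff f (Suc n)"
  have a: "a \<noteq> 0" using n by (metis a_def leading_coeff_0_iff degree_0 nat.distinct(1))
  \<comment> \<open>With \<open>t = - h\<close> the second formula of
    \<open>coeff_pcompose_affine\<close> gives zero.\<close>
  define h where "h = coeff f n / (of_nat (Suc n) * a)"
  obtain u v where "quotient_of h = (u, v)" by fastforce
  then have v: "v > 0" and h: "h = of_int u / of_int v"
    using quotient_of_denom_pos quotient_of_div by blast+
  \<comment> \<open>The inner polynomial inverts \<open>x \<mapsto> v * x + u\<close>, so
    \<open>g\<close> at \<open>v * x + u\<close> is \<open>f\<close> at \<open>x\<close>.\<close>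
  define g where "g = f \<circ>\<^sub>p [:-h, 1 / of_int v:]"
  obtain m G where m: "m > 0" and G: "smult (of_int m) g = map_poly of_int G"
    using rat_poly_clear_denominators by blast
  have coeff_G: "of_int (coeff G i) = of_int m * coeff g i" for i
    using arg_cong[OF G, of "\<lambda>p. coeff p i"] by (simp add: coeff_map_poly)
  have "degree g \<le> Suc n"
    unfolding g_def by (rule order_trans[OF degree_pcompose_le]) (simp add: n)
  then have deg_G: "coeff G i = 0" if "i > Suc n" for i
    using that coeff_G[of i] by (simp add: coeff_eq_0)
  have "coeff g (Suc n) \<noteq> 0"
    unfolding g_def by (subst coeff_pcompose_affine(1)) (use n v a in \<open>auto simp: a_def\<close>)
  then have lead_G: "coeff G (Suc n) \<noteq> 0"
    using coeff_G[of "Suc n"] m by auto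
  have "coeff g n = 0"
    unfolding g_def
    by (subst coeff_pcompose_affine(2)) (use n a in \<open>auto simp: h_def a_def simp del: of_nat_Suc\<close>)
  then have "coeff G n = 0" using coeff_G[of n] by simp
  define Q where "Q = G - monom (coeff G (Suc n)) (Suc n)"
  \<comment> \<open>Coefficient \<open>n\<close> vanishes by the choice of \<open>h\<close>,
    coefficient \<open>Suc n\<close> by subtraction. As \<open>n \<ge> 1\<close>, this gives
    \<open>degree Q + 2 \<le> Suc n\<close>.\<close>
  have "degree Q \<le> n - 1"
  proof (rule degree_le, intro allI impI)
    fix i assume "i > n - 1"
    then consider "i = n" | "i = Suc n" | "i > Suc n" by linarith
    then show "coeff Q i = 0"
      by cases (use deg_G \<open>coeff G n = 0\<close> in \<open>auto simp: Q_def\<close>)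
  qed
  moreover have "Q \<noteq> 0"
  proof
    assume "Q = 0"
    have mono: "smult (of_int m) g = monom (of_int (coeff G (Suc n))) (Suc n)"
      unfolding G
    proof (rule poly_eqI)
      fix i
      show "coeff (map_poly of_int G) i
          = coeff (monom (of_int (coeff G (Suc n))) (Suc n) :: rat poly) i"
        using arg_cong[OF \<open>Q = 0\<close>, of "\<lambda>p. coeff p i"]
        by (cases "i = Suc n") (simp_all add: Q_def coeff_map_poly)
    qed
    have only_root: "y = - of_int u / of_int v" if "poly (map_poly of_rat f) y = 0" for y :: complex
    proof -
      let ?y = "of_int v * y + of_int u"
      have "poly (map_poly of_rat (smult (of_int m) g)) ?y = 0"
        using that v unfolding g_def map_poly_of_rat_smult map_poly_of_rat_pcompose poly_smult poly_pcompose
        by (simp add: map_poly_pCons h of_rat_minus of_rat_divide field_simps)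
      then have "?y = 0"
        unfolding mono using lead_G by (auto simp: map_poly_of_rat_monom poly_monom)
      then show ?thesis using v by (simp add: field_simps eq_neg_iff_add_eq_0)
    qed
    then show False using roots \<open>z \<noteq> w\<close> by metis
  qed
  moreover have "of_int m * poly f (of_int x)
      = of_int (coeff G (Suc n) * (v * x + u) ^ degree f + poly Q (v * x + u))" for x
  proof -
    have "of_int m * poly f (of_int x) = poly (smult (of_int m) g) (of_int (v * x + u))"
      using v by (simp add: g_def poly_pcompose h field_simps)
    also have "\<dots> = of_int (poly G (v * x + u))"
      unfolding G by (rule poly_map_poly_of_int)
    finally show ?thesis by (simp add: Q_def poly_monom n)
  qed
  ultimately show thesis using n by (intro that[OF m lead_G]) auto
qed

section \<open>Growth against radical for products of double factorials\<close>

text \<open>After squaring, \<open>n!!\<close> is compared with \<open>n!\<close>, and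
  \<open>(B\<^sup>2) ^ n / n!\<close> tends to zero as the general term of the exponential
  series.\<close>

lemma finite_double_factorial_le_exponential:
  fixes K B :: real
  shows "finite {n. double_factorial n \<le> K * B ^ n}"
proof -
  have "(\<lambda>n. K\<^sup>2 * (inverse (fact n) * (B\<^sup>2) ^ n)) \<longlonglongrightarrow> K\<^sup>2 * 0"
    by (intro tendsto_mult_left summable_LIMSEQ_zero summable_exp)
  then have "\<forall>\<^sub>F n in sequentially. K\<^sup>2 * (inverse (fact n) * (B\<^sup>2) ^ n) < 1"
    by (rule order_tendstoD) simp
  then obtain N where N: "\<And>n. n \<ge> N \<Longrightarrow> K\<^sup>2 * (inverse (fact n) * (B\<^sup>2) ^ n) < 1"
    by (auto simp: eventually_sequentially)
  have "n < N" if "double_factorial n \<le> K * B ^ n" for n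
  proof (rule ccontr)
    assume "\<not> n < N"
    then have "(K * B ^ n)\<^sup>2 < fact n"
      using N[of n] by (simp add: field_simps power_mult_distrib flip: power_mult)
    also have "\<dots> = real (fact n)" by simp
    also have "\<dots> \<le> real ((double_factorial n)\<^sup>2)"
      using fact_le_double_factorial_square by (rule of_nat_mono)
    also have "\<dots> \<le> (K * B ^ n)\<^sup>2"
      using power_mono[OF that, of 2] by simp
    finally show False by simp
  qed
  then show ?thesis by (auto intro: finite_subset[of _ "{..<N}"])
qed

text \<open>A prime factor of the product divides \<open>c\<close>, some \<open>A i\<close>, or some
  \<open>n i!!\<close>; in the last case it is at most \<open>N\<close> and is counted in the
  primorial of \<open>N\<close>. Only the factor \<open>4 ^ N\<close> depends on the
  exponents.\<close>

lemma int_radical_double_factorial_prod_le: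
  fixes c :: int and A n :: "'i \<Rightarrow> nat"
  assumes "finite I" "c \<noteq> 0" and A: "\<And>i. i \<in> I \<Longrightarrow> A i > 0" and n: "\<And>i. i \<in> I \<Longrightarrow> n i \<le> N"
  shows "int_radical (c * (\<Prod>i\<in>I. int (double_factorial (n i)) * int (A i) ^ n i))
    \<le> int_radical (c * (\<Prod>i\<in>I. int (A i))) * 4 ^ N"
proof -
  let ?L = "c * (\<Prod>i\<in>I. int (double_factorial (n i)) * int (A i) ^ n i)"
  let ?T = "c * (\<Prod>i\<in>I. int (A i))"
  let ?P = "{p::nat. prime p \<and> p \<le> N}"
  have finP: "finite ?P" by (rule finite_subset[of _ "{..N}"]) auto
  have T: "?T \<noteq> 0" using assms by (auto dest: A)
  have "int_radical ?L dvd int_radical ?T * int (\<Prod>?P)"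
    unfolding int_radical_def[of ?L]
  proof (rule prod_primes_dvd)
    fix p assume p: "p \<in> prime_factors ?L"
    then have "prime p" "p dvd ?L" by auto
    then consider "p dvd ?T" | i where "i \<in> I" "p dvd int (double_factorial (n i))"
      using \<open>finite I\<close> by (auto simp: prime_dvd_mult_iff prime_dvd_prod_iff dest: prime_dvd_power)
    then show "p dvd int_radical ?T * int (\<Prod>?P)"
    proof cases
      case 1
      then have "p \<in> prime_factors ?T"
        using T \<open>prime p\<close> by (simp add: prime_factors_dvd)
      then have "p dvd int_radical ?T"
        unfolding int_radical_def using dvd_prodI[of "prime_factors ?T" p "\<lambda>x. x"] by auto
      then show ?thesis by simp
    next
      case 2
      obtain q where q: "p = int q" "prime q"
        using \<open>prime p\<close> by (metis prime_int_nat_transfer prime_ge_0_int nat_0_le)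
      then have "q \<le> N"
        using 2 prime_dvd_double_factorial_le[of q "n i"] n[of i] by auto
      then have "q dvd \<Prod>?P"
        using finP q dvd_prodI[of ?P q "\<lambda>x. x"] by auto
      then show ?thesis unfolding q by (intro dvd_mult) (simp only: of_nat_dvd_iff)
    qed
  qed auto
  then have "int_radical ?L \<le> int_radical ?T * int (\<Prod>?P)"
    by (rule zdvd_imp_le)
      (intro mult_pos_pos int_radical_pos, auto intro!: prod_pos simp: prime_gt_0_nat)
  also have "\<dots> \<le> int_radical ?T * int (4 ^ N)"
    using primorial_le int_radical_pos by (intro mult_left_mono) (auto simp: less_imp_le simp del: of_nat_prod)
  finally show ?thesis by simp
qed

section \<open>Finiteness of the solution set\<close>

theorem theorem1p7:
  fixes f :: "rat poly" and b :: int and r :: nat and A :: "nat \<Rightarrow> nat"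
  assumes "ABC_conjecture"
    and "degree f \<ge> 2"
    and "\<not> (\<exists>c k. f = monom c k)"
    and "\<exists>z w :: complex. z \<noteq> w \<and> poly (map_poly of_rat f) z = 0 \<and> poly (map_poly of_rat f) w = 0"
    and "b \<noteq> 0"
    and "\<forall>i\<in>{1..r}. A i > 0"
  shows "finite {(x :: int, n :: nat \<Rightarrow> nat).
           n \<in> {1..r} \<rightarrow>\<^sub>E {1..} \<and>
           of_int b * (\<Prod>i=1..r. of_nat (double_factorial (n i)) * of_nat (A i) ^ n i)
             = poly f (of_int x)}" (is "finite ?S")
proof -
  obtain z w :: complex where "z \<noteq> w"
    "poly (map_poly of_rat f) z = 0" "poly (map_poly of_rat f) w = 0"
    using assms(4) by blast
  from depressed_integer_form[OF assms(2) this]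
  obtain m u v \<alpha> :: int and Q :: "int poly"
    where m: "m > 0" and \<alpha>: "\<alpha> \<noteq> 0" and Q: "Q \<noteq> 0" "degree Q + 2 \<le> degree f"
      and f_eq: "\<And>x :: int. of_int m * poly f (of_int x)
       = of_int (\<alpha> * (v * x + u) ^ degree f + poly Q (v * x + u))" by metis
  define G where "G y = \<alpha> * y ^ degree f + poly Q y" for y
  define W where "W n = b * (\<Prod>i=1..r. int (double_factorial (n i)) * int (A i) ^ n i)" for n
  define T where "T = m * b * (\<Prod>i=1..r. int (A i))"
  have sol: "m * W n = G (v * x + u)" "of_int (W n) = poly f (of_int x)" if "(x, n) \<in> ?S" for x n
  proof -
    show W: "of_int (W n) = poly f (of_int x)"
      using that by (simp add: W_def)
    then have "(of_int (m * W n) :: rat) = of_int (G (v * x + u))"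
      unfolding G_def f_eq[symmetric] by simp
    then show "m * W n = G (v * x + u)" by (simp only: of_int_eq_iff)
  qed
  have W_nz: "W n \<noteq> 0" for n
    using assms(5,6) double_factorial_pos by (auto simp: W_def)
  have df_le: "int (double_factorial (n i)) \<le> \<bar>m * W n\<bar>" if "i \<in> {1..r}" for n i
  proof -
    have "int (double_factorial (n i)) dvd m * W n"
      unfolding W_def using that
      by (intro dvd_mult dvd_trans[OF dvd_triv_left dvd_prodI[
            where f = "\<lambda>i. int (double_factorial (n i)) * int (A i) ^ n i"]]) auto
    then show ?thesis using W_nz[of n] m dvd_imp_le_int[of "m * W n"] by fastforce
  qed
  obtain K k where K: "\<And>y. y \<noteq> 0 \<Longrightarrow> poly Q y \<noteq> 0 \<Longrightarrow> G y \<noteq> 0 \<Longrightarrow>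
       real_of_int \<bar>G y\<bar> \<le> K * real_of_int (int_radical (G y)) ^ k"
    using ABC_abs_poly_value_le[OF assms(1) \<alpha> Q(2)] unfolding G_def by metis
  define C where "C = \<bar>K\<bar> * real_of_int (int_radical T) ^ k"
  define bad where "bad = {y. y = 0 \<or> poly Q y = 0}"
  have "finite bad" unfolding bad_def using poly_roots_finite[OF Q(1)] by (simp add: Collect_disj_eq)
  then have "finite ((\<lambda>y. nat \<bar>G y\<bar>) ` bad)" by simp
  then obtain N1 where N1: "\<And>y. y \<in> bad \<Longrightarrow> nat \<bar>G y\<bar> \<le> N1"
    unfolding finite_nat_set_iff_bounded_le by auto
  obtain N2 where N2: "\<And>n. double_factorial n \<le> C * (4 ^ k) ^ n \<Longrightarrow> n \<le> N2"
    using finite_double_factorial_le_exponential[of C "4 ^ k"]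
    unfolding finite_nat_set_iff_bounded_le by auto
  define N where "N = max N1 N2"
  have bound: "n i \<le> N" if S: "(x, n) \<in> ?S" and i: "i \<in> {1..r}" for x n i
  proof (cases "v * x + u \<in> bad")
    case True
    \<comment> \<open>Here the trivial bound \<open>n i \<le> n i!!\<close> suffices, since
      \<open>G\<close> takes only finitely many values on \<open>bad\<close>.\<close>
    have "int (n i) \<le> \<bar>G (v * x + u)\<bar>"
      using df_le[OF i, of n] double_factorial_ge[of "n i"] sol(1)[OF S] by linarith
    then show ?thesis using N1[OF True] by (simp add: N_def)
  next
    case False
    \<comment> \<open>One maximal exponent both bounds the radical from above and, through its own
      double factorial, the value from below.\<close>
    define M where "M = Max (n ` {1..r})"
    have M: "n j \<le> M" if "j \<in> {1..r}" for j
      using that by (simp add: M_def)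
    have "M \<in> n ` {1..r}" unfolding M_def using i by (intro Max_in) auto
    then obtain j where j: "j \<in> {1..r}" "n j = M" by auto
    have rad: "int_radical (m * W n) \<le> int_radical T * 4 ^ M"
      unfolding W_def T_def mult.assoc[symmetric] using M m assms(5,6)
      by (intro int_radical_double_factorial_prod_le) auto
    have "real (double_factorial M) \<le> real_of_int \<bar>m * W n\<bar>"
      using df_le[OF j(1), of n] unfolding j(2) by linarith
    also have "\<dots> \<le> K * real_of_int (int_radical (m * W n)) ^ k"
      using K[of "v * x + u"] False W_nz[of n] m unfolding sol(1)[OF S, symmetric] by (simp add: bad_def)
    also have "\<dots> \<le> \<bar>K\<bar> * real_of_int (int_radical T * 4 ^ M) ^ k"
      using rad int_radical_pos[of "m * W n"]
      by (intro mult_mono power_mono) (simp_all only: of_int_le_iff of_int_0_le_iff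
        abs_ge_self abs_ge_zero less_imp_le zero_le_power)
    also have "\<dots> = C * (4 ^ k) ^ M"
      by (simp add: C_def power_mult_distrib mult.commute flip: power_mult)
    \<comment> \<open>\<open>C\<close> and \<open>k\<close> do not depend on the solution, so
      neither does \<open>N2\<close>.\<close>
    finally have "M \<le> N2" by (rule N2)
    then show ?thesis using M[OF i] by (simp add: N_def)
  qed
  have fin_x: "finite {x :: int. of_int c = poly f (of_int x)}" for c
  proof -
    have "f - [:of_int c:] \<noteq> 0" using assms(2) by auto
    then have "finite {q. poly (f - [:of_int c:]) q = 0}" by (rule poly_roots_finite)
    then have "finite ((of_int :: int \<Rightarrow> rat) -` {q. poly (f - [:of_int c:]) q = 0})"
      by (rule finite_vimageI) (simp add: inj_def)
    then show ?thesis by (rule rev_finite_subset) auto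
  qed
  \<comment> \<open>The pairs are swapped so that the finitely many bounded tuples \<open>n\<close>
    index the finite fibres of \<open>x\<close>.\<close>
  have "?S \<subseteq> (\<lambda>(n, x). (x, n)) ` (SIGMA n:{1..r} \<rightarrow>\<^sub>E {..N}. {x. of_int (W n) = poly f (of_int x)})"
  proof safe
    fix x n assume n: "n \<in> {1..r} \<rightarrow>\<^sub>E {1..}" and eq: "of_int b * (\<Prod>i=1..r. of_nat (double_factorial (n i)) * of_nat (A i) ^ n i)
             = poly f (of_int x)"
    then have S: "(x, n) \<in> ?S" by simp
    have "n \<in> {1..r} \<rightarrow>\<^sub>E {..N}"
      using n bound[OF S] by (auto simp: PiE_iff)
    then show "(x, n) \<in> (\<lambda>(n, x). (x, n)) `
        (SIGMA n:{1..r} \<rightarrow>\<^sub>E {..N}. {x. of_int (W n) = poly f (of_int x)})"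
      using sol(2)[OF S] by force
  qed
  moreover have "finite (SIGMA n:{1..r} \<rightarrow>\<^sub>E {..N}. {x. of_int (W n) = poly f (of_int x)})"
    by (intro finite_SigmaI finite_PiE fin_x) auto
  ultimately show ?thesis by (meson finite_imageI finite_subset)
qed

end
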